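(* Let $k\ge 1$ and $r\ge 1$ be integers, let $0<p<1$ and $q=1-p$. Then every mode $m=m_k(r,p)$ of the negative binomial distribution of order $k$, type I, with parameters $r$ and $p$ satisfies $$m \;\le\; kr+\left\lfloor \frac{(r-1)\left[1-p^k(1+kq)\right]}{q\,p^k}\right\rfloor .$$
   Context: For positive integers $k,r$ and $0<p<1$, $q=1-p$, an integer-valued random variable $X$ has the negative binomial distribution of order $k$, type I, with parameters $r$ and $p$, if its probability mass function is $$P_n=P(X=n)=p^n\sum \binom{n_1+n_2+\cdots+n_k+r-1}{n_1,\,n_2,\ldots,n_k,\,r-1}\left(\frac{q}{p}\right)^{n_1+n_2+\cdots+n_k}\quad (n\ge kr),$$ and $P_n=0$ for $n<kr$, where the sum is over all $k$-tuples of non-negative integers $(n_1,\ldots,n_k)$ with $n_1+2n_2+\cdots+kn_k=n-kr$, and $\binom{N}{a_1,\ldots,a_{k+1}}=\frac{N!}{a_1!\cdots a_{k+1}!}$ denotes the multinomial coefficient. A mode $m_k(r,p)$ of this distribution is an integer $n$ at which $P_n$ attains its maximum (there may be several). $\lfloor x\rfloor$ denotes the greatest integer not exceeding $x$. *)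

theory Defs
  imports Complex_Main "HOL-Library.FuncSet"
begin

text \<open>
  A tuple \<open>(n\<^sub>1, \<dots>, n\<^sub>k)\<close> is a function on the index set \<open>{1..k}\<close>, taken to be extensional (undefined
  outside \<open>{1..k}\<close>) so that each tuple is counted exactly once and the set below is finite.
\<close>

definition weighted_tuples :: "nat \<Rightarrow> nat \<Rightarrow> (nat \<Rightarrow> nat) set" where
  "weighted_tuples k N = {a \<in> {1..k} \<rightarrow>\<^sub>E UNIV. (\<Sum>i=1..k. i * a i) = N}"

lemma finite_weighted_tuples: "finite (weighted_tuples k N)"
proof (rule finite_subset)
  show "weighted_tuples k N \<subseteq> {1..k} \<rightarrow>\<^sub>E {..N}"
  proof
    fix a assume a: "a \<in> weighted_tuples k N"
    have "a i \<le> N" if i: "i \<in> {1..k}" for i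
    proof -
      have "a i \<le> i * a i" using i by simp
      also have "\<dots> \<le> (\<Sum>j=1..k. j * a j)"
        using i by (intro member_le_sum) auto
      finally show ?thesis using a by (simp add: weighted_tuples_def)
    qed
    then show "a \<in> {1..k} \<rightarrow>\<^sub>E {..N}"
      using a by (auto simp: weighted_tuples_def PiE_iff)
  qed
qed (auto intro: finite_PiE)

text \<open>
  \<open>multinomial I a\<close> has \<open>N = (\<Sum>i\<in>I. a i)\<close> as its upper entry.
\<close>

definition multinomial :: "nat set \<Rightarrow> (nat \<Rightarrow> nat) \<Rightarrow> real" where
  "multinomial I a = fact (\<Sum>i\<in>I. a i) / (\<Prod>i\<in>I. fact (a i))"

text \<open>
  The probability mass function \<open>P\<^sub>n\<close> of the negative binomial distribution of order \<open>k\<close>, type I,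
  with parameters \<open>r\<close> and \<open>p\<close>. The entry \<open>r - 1\<close> of the multinomial coefficient is placed at
  index \<open>k + 1\<close>. Since \<open>n \<ge> kr\<close> in the second branch, the conversions \<open>nat\<close> truncate nothing
  there.
\<close>

definition negbin_order_pmf :: "nat \<Rightarrow> nat \<Rightarrow> real \<Rightarrow> int \<Rightarrow> real" where
  "negbin_order_pmf k r p n =
     (if n < int (k * r) then 0
      else p ^ nat n *
        (\<Sum>a\<in>weighted_tuples k (nat (n - int (k * r))).
           multinomial {1..k + 1} (a(k + 1 := r - 1)) * ((1 - p) / p) ^ (\<Sum>i=1..k. a i)))"

definition is_mode :: "(int \<Rightarrow> real) \<Rightarrow> int \<Rightarrow> bool" where
  "is_mode P m \<longleftrightarrow> (\<forall>n. P n \<le> P m)"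

end

theory Submission
  imports Defs
begin

text \<open>
  Put \<open>q\<^sub>i = q p\<^sup>i\<^sup>-\<^sup>1\<close>. Removing one unit from the \<open>i\<close>-th entry of a tuple and summing the resulting
  relation between multinomial coefficients with weights \<open>M + (r - 1) i\<close> gives
  \<open>M P(kr + M) = (\<Sum>i. q\<^sub>i (M + (r - 1) i) P(kr + M - i))\<close>. At a mode \<open>kr + M\<close> every value on the right is at
  most \<open>P(kr + M) > 0\<close>, so \<open>M (1 - (\<Sum>i. q\<^sub>i)) \<le> (r - 1) (\<Sum>i. i q\<^sub>i)\<close>, where \<open>(\<Sum>i. q\<^sub>i) = 1 - p\<^sup>k\<close> and
  \<open>q (\<Sum>i. i q\<^sub>i) = 1 - p\<^sup>k (1 + k q)\<close>.
\<close>

section \<open>Effect of raising one tuple entry on multinomial coefficients and weights\<close>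

lemma multinomial_fun_upd_Suc:
  assumes "finite I" "i \<in> I"
  shows "real (Suc (a i)) * multinomial I (a(i := Suc (a i)))
           = real (Suc (\<Sum>j\<in>I. a j)) * multinomial I a"
proof -
  let ?b = "a(i := Suc (a i))"
  have "(\<Sum>j\<in>I. ?b j) = ?b i + (\<Sum>j\<in>I - {i}. ?b j)"
    using assms by (simp add: sum.remove)
  also have "(\<Sum>j\<in>I - {i}. ?b j) = (\<Sum>j\<in>I - {i}. a j)"
    by (rule sum.cong) auto
  finally have sum: "(\<Sum>j\<in>I. ?b j) = Suc (\<Sum>j\<in>I. a j)"
    using assms by (simp add: sum.remove)
  have "(\<Prod>j\<in>I. fact (?b j) :: real) = fact (?b i) * (\<Prod>j\<in>I - {i}. fact (?b j))"
    using assms by (simp add: prod.remove)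
  also have "(\<Prod>j\<in>I - {i}. fact (?b j) :: real) = (\<Prod>j\<in>I - {i}. fact (a j))"
    by (rule prod.cong) auto
  finally have "(\<Prod>j\<in>I. fact (?b j) :: real) = real (Suc (a i)) * (\<Prod>j\<in>I. fact (a j))"
    using assms by (simp add: prod.remove algebra_simps)
  then show ?thesis
    unfolding multinomial_def sum by (simp add: divide_simps del: of_nat_Suc)
qed

text \<open>The variable \<open>x\<close> stands for \<open>(1 - p) / p\<close>. The power of
  \<open>p\<close> in front of the mass function is left out until
  \<open>negbin_order_pmf_recurrence\<close>, so that the argument up to there only concerns
  tuples.\<close>

definition tuple_weight :: "nat \<Rightarrow> nat \<Rightarrow> real \<Rightarrow> (nat \<Rightarrow> nat) \<Rightarrow> real" where
  "tuple_weight k r x a = multinomial {1..k + 1} (a(k + 1 := r - 1)) * x ^ (\<Sum>i=1..k. a i)"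

lemma tuple_weight_pos: "x > 0 \<Longrightarrow> tuple_weight k r x a > 0"
  by (auto simp: tuple_weight_def multinomial_def intro!: mult_pos_pos divide_pos_pos prod_pos)

text \<open>Needed for two choices of \<open>f\<close>: the constant 1 tracks the number of units,
  the identity tracks the weighted total that defines \<open>weighted_tuples\<close>.\<close>

lemma sum_fun_upd_Suc:
  fixes f :: "nat \<Rightarrow> nat"
  assumes "finite I" "i \<in> I"
  shows "(\<Sum>j\<in>I. f j * (a(i := Suc (a i))) j) = f i + (\<Sum>j\<in>I. f j * a j)"
proof -
  have "(\<Sum>j\<in>I - {i}. f j * (a(i := Suc (a i))) j) = (\<Sum>j\<in>I - {i}. f j * a j)"
    by (rule sum.cong) auto
  with assms show ?thesis by (simp add: sum.remove)
qed

text \<open>Since \<open>i \<le> k\<close>, the entry \<open>r - 1\<close> at index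
  \<open>k + 1\<close> is untouched, while the upper entry of the multinomial coefficient rises by
  one to \<open>r\<close> plus the old entry sum. The factor \<open>x\<close> comes from the
  exponent, which also rises by one.\<close>

lemma tuple_weight_fun_upd_Suc:
  assumes "i \<in> {1..k}" "r \<ge> 1"
  shows "real (Suc (a i)) * tuple_weight k r x (a(i := Suc (a i)))
           = real (r + (\<Sum>j=1..k. a j)) * x * tuple_weight k r x a"
proof -
  let ?c = "a(k + 1 := r - 1)"
  have upd: "(a(i := Suc (a i)))(k + 1 := r - 1) = ?c(i := Suc (?c i))"
    using assms by (auto simp: fun_eq_iff)
  have c: "?c i = a i" using assms by auto
  have "(\<Sum>j\<in>{1..k + 1}. ?c j) = (\<Sum>j=1..k. ?c j) + (r - 1)" by simp
  also have "(\<Sum>j=1..k. ?c j) = (\<Sum>j=1..k. a j)" by (rule sum.cong) auto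
  finally have "Suc (\<Sum>j\<in>{1..k + 1}. ?c j) = r + (\<Sum>j=1..k. a j)"
    using assms by simp
  then have m: "real (Suc (a i)) * multinomial {1..k + 1} (?c(i := Suc (?c i)))
          = real (r + (\<Sum>j=1..k. a j)) * multinomial {1..k + 1} ?c"
    using multinomial_fun_upd_Suc[of "{1..k + 1}" i ?c] assms c by simp
  have s: "(\<Sum>j=1..k. (a(i := Suc (a i))) j) = Suc (\<Sum>j=1..k. a j)"
    using sum_fun_upd_Suc[of "{1..k}" i "\<lambda>_. 1" a] assms by simp
  have "real (Suc (a i)) * tuple_weight k r x (a(i := Suc (a i)))
          = (real (Suc (a i)) * multinomial {1..k + 1} (?c(i := Suc (?c i))))
              * x ^ Suc (\<Sum>j=1..k. a j)"
    unfolding tuple_weight_def upd s by simp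
  also have "\<dots> = real (r + (\<Sum>j=1..k. a j)) * x * tuple_weight k r x a"
    unfolding m by (simp add: tuple_weight_def)
  finally show ?thesis .
qed

lemma weighted_tuples_fun_upd_Suc:
  assumes "i \<in> {1..k}"
  shows "a(i := Suc (a i)) \<in> weighted_tuples k (M + i) \<longleftrightarrow> a \<in> weighted_tuples k M"
proof -
  have "a(i := Suc (a i)) \<in> {1..k} \<rightarrow>\<^sub>E UNIV \<longleftrightarrow> a \<in> {1..k} \<rightarrow>\<^sub>E UNIV"
    using assms by (auto simp: PiE_iff extensional_def)
  then show ?thesis
    using sum_fun_upd_Suc[of "{1..k}" i "\<lambda>j. j" a] assms
    by (auto simp: weighted_tuples_def)
qed

lemma weighted_tuples_entry_bound:
  assumes "a \<in> weighted_tuples k M" "i \<in> {1..k}"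
  shows "i * a i \<le> M"
proof -
  have "i * a i \<le> (\<Sum>j=1..k. j * a j)"
    using assms(2) by (intro member_le_sum) auto
  with assms(1) show ?thesis by (simp add: weighted_tuples_def)
qed

section \<open>Recurrence for the weight sums\<close>

definition weight_sum :: "nat \<Rightarrow> nat \<Rightarrow> real \<Rightarrow> nat \<Rightarrow> real" where
  "weight_sum k r x M = (\<Sum>a\<in>weighted_tuples k M. tuple_weight k r x a)"

text \<open>Raising entry \<open>i\<close> is a bijection from the tuples of total
  \<open>M - i\<close> onto those of total \<open>M\<close> with \<open>a i \<noteq> 0\<close>;
  tuples with \<open>a i = 0\<close> contribute nothing on the right.\<close>

lemma weight_sum_shift:
  assumes "i \<in> {1..k}" "r \<ge> 1"
  shows "(if i \<le> M then x * weight_sum k r x (M - i) else 0)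
           = (\<Sum>a\<in>weighted_tuples k M.
                real (a i) / real (r - 1 + (\<Sum>j=1..k. a j)) * tuple_weight k r x a)"
    (is "_ = sum ?g _")
proof (cases "i \<le> M")
  case False
  \<comment> \<open>A nonzero entry would give \<open>i \<le> i * a i \<le> M\<close>.\<close>
  then have "?g a = 0" if "a \<in> weighted_tuples k M" for a
    using weighted_tuples_entry_bound[OF that assms(1)] by (cases "a i") auto
  then have "sum ?g (weighted_tuples k M) = 0" by (intro sum.neutral) blast
  with False show ?thesis by (simp only: if_False)
next
  case True
  let ?up = "\<lambda>a::nat \<Rightarrow> nat. a(i := Suc (a i))"
  let ?A = "{a \<in> weighted_tuples k M. a i \<noteq> 0}"
  have "(\<Sum>a\<in>weighted_tuples k M. ?g a) = (\<Sum>a\<in>?A. ?g a)"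
    by (rule sum.mono_neutral_right) (auto simp: finite_weighted_tuples)
  also have "\<dots> = (\<Sum>b\<in>weighted_tuples k (M - i). x * tuple_weight k r x b)"
  proof (rule sum.reindex_bij_witness[of _ ?up "\<lambda>a. a(i := a i - 1)"])
    fix a assume a: "a \<in> ?A"
    define b where "b = a(i := a i - 1)"
    have ab: "a = ?up b" using a by (auto simp: b_def fun_eq_iff)
    show "?up (a(i := a i - 1)) = a" using ab unfolding b_def by simp
    have "?up b \<in> weighted_tuples k (M - i + i)"
      using a True unfolding ab[symmetric] by simp
    then show "a(i := a i - 1) \<in> weighted_tuples k (M - i)"
      unfolding weighted_tuples_fun_upd_Suc[OF assms(1)] b_def .
    have "(\<Sum>j=1..k. a j) = Suc (\<Sum>j=1..k. b j)"
      using sum_fun_upd_Suc[of "{1..k}" i "\<lambda>_. 1" b] assms unfolding ab[symmetric] by simp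
    \<comment> \<open>The denominator of \<open>?g a\<close> thus equals the factor produced by
      \<open>tuple_weight_fun_upd_Suc\<close>, and the two cancel.\<close>
    then have "r - 1 + (\<Sum>j=1..k. a j) = r + (\<Sum>j=1..k. b j)"
      using assms by simp
    moreover have "a i = Suc (b i)" using a by (simp add: b_def)
    ultimately have "?g a
        = (real (Suc (b i)) * tuple_weight k r x (?up b)) / real (r + (\<Sum>j=1..k. b j))"
      unfolding ab[symmetric] by (simp only: times_divide_eq_left)
    also have "\<dots> = x * tuple_weight k r x b"
      unfolding tuple_weight_fun_upd_Suc[OF assms] using assms by (simp del: of_nat_add)
    finally show "x * tuple_weight k r x (a(i := a i - 1)) = ?g a"
      by (simp add: b_def)
  next
    fix b assume b: "b \<in> weighted_tuples k (M - i)"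
    show "(?up b)(i := ?up b i - 1) = b" by simp
    show "?up b \<in> ?A"
      using weighted_tuples_fun_upd_Suc[OF assms(1), of b "M - i"] b True by simp
  qed
  finally show ?thesis using True by (simp add: weight_sum_def sum_distrib_left)
qed

text \<open>After exchanging the sums, a tuple with entry sum \<open>N\<close> receives the
  coefficient \<open>M * N + (r - 1) * M = M * (r - 1 + N)\<close>. The weights
  \<open>M + (r - 1) * i\<close> are chosen so that this cancels the denominator in
  \<open>weight_sum_shift\<close>.\<close>

lemma weight_sum_recurrence:
  assumes "r \<ge> 1"
  shows "real M * weight_sum k r x M
           = (\<Sum>i=1..k. (real M + (real r - 1) * real i)
                * (if i \<le> M then x * weight_sum k r x (M - i) else 0))"
proof -
  have "(\<Sum>i=1..k. (real M + (real r - 1) * real i)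
           * (if i \<le> M then x * weight_sum k r x (M - i) else 0))
      = (\<Sum>i=1..k. \<Sum>a\<in>weighted_tuples k M. (real M + (real r - 1) * real i)
           * (real (a i) / real (r - 1 + (\<Sum>j=1..k. a j)) * tuple_weight k r x a))"
    by (rule sum.cong[OF refl]) (simp only: weight_sum_shift[OF _ assms] sum_distrib_left)
  also have "\<dots> = (\<Sum>a\<in>weighted_tuples k M. \<Sum>i=1..k. (real M + (real r - 1) * real i)
           * (real (a i) / real (r - 1 + (\<Sum>j=1..k. a j)) * tuple_weight k r x a))"
    by (rule sum.swap)
  also have "\<dots> = (\<Sum>a\<in>weighted_tuples k M. real M * tuple_weight k r x a)"
  proof (rule sum.cong[OF refl])
    fix a assume a: "a \<in> weighted_tuples k M"
    let ?N = "\<Sum>j=1..k. a j"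
    let ?D = "real (r - 1 + ?N)"
    have M: "(\<Sum>i=1..k. real i * real (a i)) = real M"
      using a by (simp add: weighted_tuples_def flip: of_nat_mult of_nat_sum)
    have "(\<Sum>i=1..k. (real M + (real r - 1) * real i) * (real (a i) / ?D * tuple_weight k r x a))
        = (\<Sum>i=1..k. real M * real (a i) + (real r - 1) * (real i * real (a i)))
            * tuple_weight k r x a / ?D"
      unfolding sum_distrib_right sum_divide_distrib
      by (rule sum.cong[OF refl]) (simp add: field_simps)
    also have "(\<Sum>i=1..k. real M * real (a i) + (real r - 1) * (real i * real (a i)))
        = real M * ?D"
      using assms
      by (simp only: sum.distrib M sum_distrib_left[where r = "real M", symmetric]
          sum_distrib_left[where r = "real r - 1", symmetric])
        (simp add: of_nat_diff algebra_simps)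
    also have "real M * ?D * tuple_weight k r x a / ?D = real M * tuple_weight k r x a"
    \<comment> \<open>For \<open>M = 0\<close> and \<open>r = 1\<close> the denominator
      \<open>?D\<close> is 0, but the factor \<open>M\<close> makes both sides vanish.\<close>
    proof (cases "M = 0")
      case False
      have "?N \<noteq> 0"
      proof
        assume "?N = 0"
        then have "\<forall>i\<in>{1..k}. a i = 0" by simp
        then have "(\<Sum>i=1..k. real i * real (a i)) = 0" by (intro sum.neutral) auto
        with M False show False by simp
      qed
      then have "?D \<noteq> 0" by (simp only: of_nat_eq_0_iff add_is_0) simp
      then show ?thesis by simp
    qed simp
    finally show "(\<Sum>i=1..k. (real M + (real r - 1) * real i)
           * (real (a i) / ?D * tuple_weight k r x a)) = real M * tuple_weight k r x a" .
  qed
  finally show ?thesis by (simp add: weight_sum_def sum_distrib_left)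
qed

section \<open>Transfer to the probability mass function\<close>

lemma negbin_order_pmf_eq:
  "negbin_order_pmf k r p (int (k * r + M)) = p ^ (k * r + M) * weight_sum k r ((1 - p) / p) M"
proof -
  have "nat (int (k * r + M) - int (k * r)) = M" "\<not> int (k * r + M) < int (k * r)" by simp_all
  then show ?thesis
    by (simp only: negbin_order_pmf_def weight_sum_def tuple_weight_def if_False nat_int)
qed

text \<open>The zero tuple contributes a positive term. This makes the value at a mode positive, so
  that it can be cancelled later.\<close>

lemma negbin_order_pmf_lowest_pos:
  assumes "0 < p" "p < 1"
  shows "negbin_order_pmf k r p (int (k * r)) > 0"
proof -
  have "restrict (\<lambda>_. 0) {1..k} \<in> weighted_tuples k 0"
    by (auto simp: weighted_tuples_def)
  then have "weight_sum k r ((1 - p) / p) 0 > 0"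
    unfolding weight_sum_def
    using assms by (intro sum_pos finite_weighted_tuples tuple_weight_pos) auto
  then show ?thesis
    using negbin_order_pmf_eq[of k r p 0] assms by simp
qed

lemma negbin_order_pmf_recurrence:
  assumes "r \<ge> 1" "0 < p"
  shows "real M * negbin_order_pmf k r p (int (k * r + M))
           = (\<Sum>i=1..k. (real M + (real r - 1) * real i)
                * ((1 - p) * p ^ (i - 1) * negbin_order_pmf k r p (int (k * r + M) - int i)))"
proof -
  have "p ^ (k * r + M) * (if i \<le> M then (1 - p) / p * weight_sum k r ((1 - p) / p) (M - i) else 0)
      = (1 - p) * p ^ (i - 1) * negbin_order_pmf k r p (int (k * r + M) - int i)"
    if i: "i \<in> {1..k}" for i
  proof (cases "i \<le> M")
    case True
    \<comment> \<open>One factor \<open>p\<close> cancels the denominator of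
      \<open>(1 - p) / p\<close>, \<open>i - 1\<close> factors form the geometric weight, and the
      rest belongs to the shifted value.\<close>
    have "k * r + M = Suc ((i - 1) + (k * r + (M - i)))" using True i by auto
    then have "p ^ (k * r + M) = p * p ^ (i - 1) * p ^ (k * r + (M - i))"
      by (simp only: power_Suc power_add mult.assoc)
    moreover have "int (k * r + M) - int i = int (k * r + (M - i))" using True by simp
    ultimately show ?thesis
      using True assms by (simp only: negbin_order_pmf_eq if_True) simp
  next
    case False
    \<comment> \<open>The argument lies below \<open>k * r\<close>, where the mass function is
      0.\<close>
    then show ?thesis by (simp add: negbin_order_pmf_def)
  qed
  then show ?thesis
    unfolding negbin_order_pmf_eq[of k r p M] mult.left_commute[of "real M"]
      weight_sum_recurrence[OF assms(1)] sum_distrib_left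
    by (intro sum.cong[OF refl]) (simp only: mult.left_commute[of "p ^ (k * r + M)"])
qed

section \<open>Closed forms for the geometric weights\<close>

lemma sum_geometric_weights: "(\<Sum>i=1..k. (1 - p) * p ^ (i - 1)) = 1 - (p::real) ^ k"
  by (induction k) (auto simp: algebra_simps)

lemma sum_index_geometric_weights:
  "(1 - p) * (\<Sum>i=1..k. real i * ((1 - p) * p ^ (i - 1))) = 1 - p ^ k * (1 + real k * (1 - p))"
proof (induction k)
  case (Suc k)
  have "(1 - p) * (\<Sum>i=1..Suc k. real i * ((1 - p) * p ^ (i - 1)))
      = (1 - p) * (\<Sum>i=1..k. real i * ((1 - p) * p ^ (i - 1)))
          + (1 - p) * (real (Suc k) * ((1 - p) * p ^ k))"
    by (simp add: distrib_left)
  also have "\<dots> = 1 - p ^ Suc k * (1 + real (Suc k) * (1 - p))"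
    unfolding Suc.IH by (simp add: algebra_simps)
  finally show ?case .
qed simp

section \<open>The bound on the mode\<close>

theorem theorem2p1:
  fixes k r :: nat and p q :: real and m :: int
  assumes "k \<ge> 1" and "r \<ge> 1"
    and "0 < p" and "p < 1" and "q = 1 - p"
    and "is_mode (negbin_order_pmf k r p) m"
  shows "m \<le> int (k * r)
           + \<lfloor>(real r - 1) * (1 - p ^ k * (1 + real k * q)) / (q * p ^ k)\<rfloor>"
proof -
  let ?P = "negbin_order_pmf k r p"
  let ?w = "\<lambda>i::nat. (1 - p) * p ^ (i - 1)"
  have max: "?P n \<le> ?P m" for n using assms(6) by (simp add: is_mode_def)
  have pos: "?P m > 0"
    using max negbin_order_pmf_lowest_pos[OF assms(3,4)] by (rule order_less_le_trans[rotated])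
  \<comment> \<open>Positivity excludes the zero branch of the mass function, so \<open>m\<close>
    can be written as \<open>k * r + M\<close> with a natural number \<open>M\<close>.\<close>
  then have "\<not> m < int (k * r)" by (auto simp: negbin_order_pmf_def)
  then have "m = int (k * r + nat (m - int (k * r)))" by simp
  then obtain M where m: "m = int (k * r + M)" by blast
  have "real M * ?P m
      = (\<Sum>i=1..k. (real M + (real r - 1) * real i) * (?w i * ?P (m - int i)))"
    unfolding m using negbin_order_pmf_recurrence[OF assms(2,3)] .
  \<comment> \<open>The factors in front of \<open>?P (m - int i)\<close> are nonnegative because
    \<open>r \<ge> 1\<close> and \<open>0 < p < 1\<close>.\<close>
  also have "\<dots> \<le> (\<Sum>i=1..k. (real M + (real r - 1) * real i) * (?w i * ?P m))"
    using assms by (intro sum_mono mult_left_mono max) auto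
  also have "\<dots> = (\<Sum>i=1..k. real M * ?w i + (real r - 1) * (real i * ?w i)) * ?P m"
    by (simp only: sum_distrib_right) (simp add: algebra_simps)
  also have "(\<Sum>i=1..k. real M * ?w i + (real r - 1) * (real i * ?w i))
      = real M * (1 - p ^ k) + (real r - 1) * (\<Sum>i=1..k. real i * ?w i)"
    by (simp only: sum.distrib sum_geometric_weights sum_distrib_left[where r = "real M", symmetric]
        sum_distrib_left[where r = "real r - 1", symmetric])
  finally have "real M \<le> real M * (1 - p ^ k) + (real r - 1) * (\<Sum>i=1..k. real i * ?w i)"
    using pos by simp
  then have "real M * p ^ k \<le> (real r - 1) * (\<Sum>i=1..k. real i * ?w i)"
    by (simp add: algebra_simps)
  \<comment> \<open>The factor \<open>q\<close> prepares the division-free closed form in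
    \<open>sum_index_geometric_weights\<close>.\<close>
  then have "q * (real M * p ^ k) \<le> q * ((real r - 1) * (\<Sum>i=1..k. real i * ?w i))"
    using assms by (intro mult_left_mono) auto
  also have "\<dots> = (real r - 1) * (1 - p ^ k * (1 + real k * q))"
    unfolding assms(5) sum_index_geometric_weights[symmetric] by (rule mult.left_commute)
  finally have "real M \<le> (real r - 1) * (1 - p ^ k * (1 + real k * q)) / (q * p ^ k)"
    using assms by (simp add: pos_le_divide_eq mult_ac)
  then have "int M \<le> \<lfloor>(real r - 1) * (1 - p ^ k * (1 + real k * q)) / (q * p ^ k)\<rfloor>"
    by (simp add: le_floor_iff)
  then show ?thesis unfolding m by simp
qed

end
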